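(* Consider the Scarf-Hirota model with endowment matrix $A$ satisfying $A\mathbf{u}=\mathbf{u}$ and $\mathbf{u}^TA=\mathbf{u}^T$, where $\mathbf{u}=(1,1,1)^T$, and excess demand functions $E_1,E_2,E_3$ (defined in the context). Let $\gamma\ge 0$ be a real number. Then the function $$g_\gamma(p_1,p_2,p_3)=\begin{cases} p_1^{2-\gamma}+p_2^{2-\gamma}+p_3^{2-\gamma}, & \text{if } \gamma\neq 2,\\ p_1p_2p_3, & \text{if } \gamma=2,\end{cases}$$ is a first integral of the system of ordinary differential equations $$\frac{dp_i}{dt}=p_i^{\gamma}E_i(\mathbf{p}),\qquad i=1,2,3,$$ on $\mathcal{D}=\{\mathbf{p}=(p_1,p_2,p_3)^T : p_1>0,\ p_2>0,\ p_3>0\}$; that is, $g_\gamma$ is constant along every solution in $\mathcal{D}$.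
   Context: Scarf-Hirota model: $\mathbf{a}_h=(a_{1h},a_{2h},a_{3h})^T$ is the initial endowment vector of consumer $h$ ($h=1,2,3$), and $A=[\mathbf{a}_1,\mathbf{a}_2,\mathbf{a}_3]=(a_{ih})$ is the real $3\times 3$ matrix with columns $\mathbf{a}_h$. It is assumed that $A\mathbf{u}=\mathbf{u}$ and $\mathbf{u}^TA=\mathbf{u}^T$ with $\mathbf{u}=(1,1,1)^T$ (all row and column sums equal $1$), and that the diagonal entries $a_{11},a_{22},a_{33}$ are $\geq 0$. Let $\mathbf{b}_1=(0,1,1)^T$, $\mathbf{b}_2=(1,0,1)^T$, $\mathbf{b}_3=(1,1,0)^T$, $B=[\mathbf{b}_1,\mathbf{b}_2,\mathbf{b}_3]$. For a price vector $\mathbf{p}=(p_1,p_2,p_3)^T$ put $f_h=\dfrac{\mathbf{p}^T\mathbf{a}_h}{\mathbf{p}^T\mathbf{b}_h}$, $\mathbf{f}=(f_1,f_2,f_3)^T$. The excess demand vector is $\mathbf{E}(\mathbf{p})=(E_1,E_2,E_3)^T=B\mathbf{f}-A\mathbf{u}$; thus $E_1=f_2+f_3-1$, $E_2=f_3+f_1-1$, $E_3=f_1+f_2-1$. *)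

theory Defs
  imports "HOL-Analysis.Analysis"
begin

section \<open>The Scarf-Hirota model\<close>

definition ones :: "real^3" where
  "ones = vector [1, 1, 1]"

text \<open>The nested \<open>vector\<close> lists the rows of a matrix, hence the transposition: the
  columns of \<open>B\<close> are the vectors \<open>b\<^sub>1, b\<^sub>2, b\<^sub>3\<close>.\<close>

definition demand_matrix :: "real^3^3" where
  "demand_matrix = transpose (vector [vector [0, 1, 1], vector [1, 0, 1], vector [1, 1, 0]])"

text \<open>Column \<open>h\<close> of \<open>A\<close> is the initial endowment of consumer \<open>h\<close>.  Only the diagonal
  entries are required to be nonnegative.\<close>

definition scarf_hirota :: "real^3^3 \<Rightarrow> bool" where
  "scarf_hirota A \<longleftrightarrow> A *v ones = ones \<and> ones v* A = ones \<and> (\<forall>i. A $ i $ i \<ge> 0)"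

definition demand_coeff :: "real^3^3 \<Rightarrow> real^3 \<Rightarrow> real^3" where
  "demand_coeff A p = (\<chi> h. (p \<bullet> column h A) / (p \<bullet> column h demand_matrix))"

definition excess_demand :: "real^3^3 \<Rightarrow> real^3 \<Rightarrow> real^3" where
  "excess_demand A p = demand_matrix *v demand_coeff A p - A *v ones"

lemma excess_demand_components:
  assumes "A *v ones = ones"
  shows "excess_demand A p $ 1 = demand_coeff A p $ 2 + demand_coeff A p $ 3 - 1"
    and "excess_demand A p $ 2 = demand_coeff A p $ 3 + demand_coeff A p $ 1 - 1"
    and "excess_demand A p $ 3 = demand_coeff A p $ 1 + demand_coeff A p $ 2 - 1"
  using assms
  by (simp_all add: excess_demand_def demand_matrix_def matrix_vector_mult_def
      transpose_def sum_3 ones_def)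

definition price_domain :: "(real^3) set" where
  "price_domain = {p. p $ 1 > 0 \<and> p $ 2 > 0 \<and> p $ 3 > 0}"

definition price_field :: "real^3^3 \<Rightarrow> real \<Rightarrow> real^3 \<Rightarrow> real^3" where
  "price_field A \<gamma> p = (\<chi> i. p $ i powr \<gamma> * excess_demand A p $ i)"

definition g :: "real \<Rightarrow> real^3 \<Rightarrow> real" where
  "g \<gamma> p = (if \<gamma> \<noteq> 2
     then p $ 1 powr (2 - \<gamma>) + p $ 2 powr (2 - \<gamma>) + p $ 3 powr (2 - \<gamma>)
     else p $ 1 * p $ 2 * p $ 3)"


section \<open>Solutions and first integrals of autonomous systems\<close>

text \<open>The time interval may be open, closed or half-open, bounded or unbounded; at an endpoint
  belonging to \<open>I\<close> the derivative is one-sided.\<close>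

definition solution_in ::
  "('a::real_normed_vector \<Rightarrow> 'a) \<Rightarrow> 'a set \<Rightarrow> real set \<Rightarrow> (real \<Rightarrow> 'a) \<Rightarrow> bool" where
  "solution_in F D I x \<longleftrightarrow> is_interval I \<and>
     (\<forall>t\<in>I. x t \<in> D \<and> (x has_vector_derivative F (x t)) (at t within I))"

definition first_integral ::
  "('a::real_normed_vector \<Rightarrow> 'a) \<Rightarrow> 'a set \<Rightarrow> ('a \<Rightarrow> real) \<Rightarrow> bool" where
  "first_integral F D H \<longleftrightarrow> (\<forall>I x. solution_in F D I x \<longrightarrow> (\<lambda>t. H (x t)) constant_on I)"

end

theory Submission
  imports Defs
begin

text \<open>
  The only economic input is Walras' law: \<open>\<^bold>p \<bullet> \<^bold>E(\<^bold>p) = 0\<close> at positive prices, since every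
  consumer spends exactly the value of the own endowment (\<open>walras_law\<close>).  The functions
  \<open>g\<close> are tailored to the speeds \<open>p\<^sub>i\<^sup>\<gamma>\<close>: for \<open>\<gamma> \<noteq> 2\<close> the \<open>i\<close>-th partial derivative of
  \<open>g\<close> is \<open>(2 - \<gamma>) p\<^sub>i powr (1 - \<gamma>)\<close>, and for \<open>\<gamma> = 2\<close> it is \<open>p\<^sub>1 p\<^sub>2 p\<^sub>3 / p\<^sub>i\<close>.  Multiplied by
  \<open>p\<^sub>i powr \<gamma>\<close>, either one becomes a factor common to all \<open>i\<close> times \<open>p\<^sub>i\<close>.  So the derivative
  of \<open>g\<close> along a solution is a multiple of \<open>\<^bold>p \<bullet> \<^bold>E(\<^bold>p)\<close> (\<open>g_derivative_along_solution\<close>),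
  hence zero, and \<open>g\<close> is constant because the time domain is an interval.
\<close>

text \<open>
  Multiplying \<open>f\<^sub>h\<close> by its denominator recovers the value \<open>\<^bold>p \<bullet> \<^bold>a\<^sub>h\<close> of the endowment of
  consumer \<open>h\<close>; summed over \<open>h\<close>, these values make up the value \<open>\<^bold>p \<bullet> A\<^bold>u\<close> of the total
  supply, which is what \<open>\<^bold>E\<close> subtracts.  Positivity of the prices serves to keep the
  denominators \<open>\<^bold>p \<bullet> \<^bold>b\<^sub>h\<close> away from zero.
\<close>

lemma walras_law:
  assumes "p \<in> price_domain"
  shows "p \<bullet> excess_demand A p = 0"
proof -
  have budget: "demand_coeff A p $ h * (p \<bullet> column h demand_matrix) = p \<bullet> column h A" for h
  proof -
    have "p \<bullet> column h demand_matrix > 0"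
      using assms exhaust_3[of h]
      by (auto simp: price_domain_def demand_matrix_def transpose_def column_def inner_vec_def sum_3)
    then show ?thesis
      by (simp add: demand_coeff_def)
  qed
  have value_of_combination: "p \<bullet> (M *v y) = (\<Sum>h\<in>UNIV. y $ h * (p \<bullet> column h M))"
    for M :: "real^3^3" and y
    by (simp add: matrix_vector_mult_def column_def inner_vec_def sum_3 algebra_simps)
  show ?thesis
    by (simp add: excess_demand_def inner_diff_right value_of_combination budget ones_def sum_3)
qed

lemma first_integralI:
  assumes "\<And>I x t. solution_in F D I x \<Longrightarrow> t \<in> I \<Longrightarrow>
    ((\<lambda>t. H (x t)) has_real_derivative 0) (at t within I)"
  shows "first_integral F D H"
  unfolding first_integral_def
proof (intro allI impI)
  fix I x
  assume sol: "solution_in F D I x"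
  then have "convex I"
    by (simp add: solution_in_def is_interval_convex)
  then show "(\<lambda>t. H (x t)) constant_on I"
    using has_field_derivative_zero_constant[OF _ assms[OF sol]]
    unfolding constant_on_def by blast
qed

lemma price_component_derivative:
  assumes "solution_in (price_field A \<gamma>) price_domain I x" and "t \<in> I"
  shows "((\<lambda>t. x t $ i) has_real_derivative x t $ i powr \<gamma> * excess_demand A (x t) $ i)
    (at t within I)"
proof -
  have "(x has_vector_derivative price_field A \<gamma> (x t)) (at t within I)"
    using assms by (simp add: solution_in_def)
  from bounded_linear.has_vector_derivative[OF bounded_linear_vec_nth this, of i]
  show ?thesis
    by (simp add: has_real_derivative_iff_has_vector_derivative price_field_def)
qed

lemma g_derivative_along_solution:
  assumes sol: "solution_in (price_field A \<gamma>) price_domain I x" and t: "t \<in> I"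
  shows "((\<lambda>t. g \<gamma> (x t)) has_real_derivative
    (if \<gamma> \<noteq> 2 then 2 - \<gamma> else x t $ 1 * x t $ 2 * x t $ 3) * (x t \<bullet> excess_demand A (x t)))
    (at t within I)"
proof -
  let ?E = "excess_demand A (x t)"
  have "x t \<in> price_domain"
    using sol t by (simp add: solution_in_def)
  then have pos: "x t $ i > 0" for i
    using exhaust_3[of i] by (auto simp: price_domain_def)
  note deriv = price_component_derivative[OF sol t]
  show ?thesis
  proof (cases "\<gamma> = 2")
    case True
    have square: "((\<lambda>t. x t $ i) has_real_derivative (x t $ i)\<^sup>2 * ?E $ i) (at t within I)" for i
      using deriv[of i] pos[of i] True by simp
    have "((\<lambda>t. x t $ 1 * x t $ 2 * x t $ 3) has_real_derivative
        x t $ 1 * x t $ 2 * x t $ 3 * (x t \<bullet> ?E)) (at t within I)"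
      by (rule derivative_eq_intros square refl)+
        (simp add: inner_vec_def sum_3 algebra_simps power2_eq_square)
    with True show ?thesis
      by (simp add: g_def)
  next
    case False
    have power: "((\<lambda>t. x t $ i powr (2 - \<gamma>)) has_real_derivative
        (2 - \<gamma>) * (x t $ i * ?E $ i)) (at t within I)" for i
    proof -
      have "x t $ i powr (2 - \<gamma> - 1) * x t $ i powr \<gamma> = x t $ i"
        using pos[of i] by (simp flip: powr_add)
      then have "(2 - \<gamma>) * (x t $ i * ?E $ i)
          = (2 - \<gamma>) * x t $ i powr (2 - \<gamma> - 1) * (x t $ i powr \<gamma> * ?E $ i)"
        by (metis mult.assoc)
      then show ?thesis
        using DERIV_chain2[OF has_real_derivative_powr[OF pos, where r = "2 - \<gamma>"] deriv]
        by (simp only:)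
    qed
    have "((\<lambda>t. x t $ 1 powr (2 - \<gamma>) + x t $ 2 powr (2 - \<gamma>) + x t $ 3 powr (2 - \<gamma>))
        has_real_derivative (2 - \<gamma>) * (x t \<bullet> ?E)) (at t within I)"
      by (rule derivative_eq_intros power refl)+
        (simp add: inner_vec_def sum_3 algebra_simps)
    with False show ?thesis
      by (simp add: g_def)
  qed
qed

theorem theorem1:
  fixes A :: "real^3^3" and \<gamma> :: real
  assumes "scarf_hirota A" and "\<gamma> \<ge> 0"
  shows "first_integral (price_field A \<gamma>) price_domain (g \<gamma>)"
proof (rule first_integralI)
  fix I x t
  assume sol: "solution_in (price_field A \<gamma>) price_domain I x" and t: "t \<in> I"
  then have "x t \<bullet> excess_demand A (x t) = 0"
    by (simp add: solution_in_def walras_law)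
  then show "((\<lambda>t. g \<gamma> (x t)) has_real_derivative 0) (at t within I)"
    using g_derivative_along_solution[OF sol t] by simp
qed

end
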